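(* Let $N\ge 2$ and $d$ be integers with $2\le d\le N^{1/4}$. Let $K(1),\dots,K(d)\in \mathrm{M}_N(\mathbb{C})$ satisfy $\sum_{s=1}^d K(s)^*K(s)=\mathrm{Id}_N$, and let $\mathcal{T}:\mathrm{M}_N(\mathbb{C})\to \mathrm{M}_N(\mathbb{C})$ be the operator $\mathcal{T}(M)=\sum_{s=1}^d K(s)MK(s)^*$. Set $m=\left\lfloor \frac{\ln N}{4\ln d}\right\rfloor$ and $\rho_d=\frac{1}{\sqrt d}$. Then $$s_2(\mathcal{T}^m)^{1/m}\ \ge\ \rho_d\,\exp\!\left(-\frac{1}{2N}\right).$$
   Context: $\mathrm{M}_N(\mathbb{C})$ is the space of $N\times N$ complex matrices, regarded as an $N^2$-dimensional Hilbert space with the scalar product $(A,B)=\mathrm{Tr}(AB^* )$. For a linear operator $\mathcal{T}$ on $\mathrm{M}_N(\mathbb{C})$, $s_1(\mathcal{T})\ge s_2(\mathcal{T})\ge\cdots\ge s_{N^2}(\mathcal{T})$ are its singular values with respect to this scalar product, counted with multiplicity (square roots of the eigenvalues of $\mathcal{T}^*\mathcal{T}$). $\mathcal{T}^m$ is the $m$-fold composition of $\mathcal{T}$. *)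

theory Defs
  imports "Jordan_Normal_Form.Schur_Decomposition"
    "HOL-Computational_Algebra.Fundamental_Theorem_Algebra"
begin

definition mat_trace :: "complex mat \<Rightarrow> complex" where
  "mat_trace A = (\<Sum>i<dim_row A. A $$ (i, i))"

text \<open>An operator on \<open>M\<^sub>N(\<complex>)\<close> is a function of type \<open>complex mat \<Rightarrow> complex mat\<close>; only its
  values on \<open>carrier_mat N N\<close> matter.\<close>

definition hs_inner :: "complex mat \<Rightarrow> complex mat \<Rightarrow> complex" where
  "hs_inner A B = mat_trace (A * mat_adjoint B)"

definition hs_adjoint :: "nat \<Rightarrow> (complex mat \<Rightarrow> complex mat) \<Rightarrow> complex mat \<Rightarrow> complex mat" where
  "hs_adjoint N T B = (THE C. C \<in> carrier_mat N N \<and>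
     (\<forall>A\<in>carrier_mat N N. hs_inner (T A) B = hs_inner A C))"

text \<open>Matrix units, enumerated row by row: for \<open>a < N\<^sup>2\<close> they form an orthonormal basis of
  \<open>M\<^sub>N(\<complex>)\<close>, in which the \<open>a\<close>-th coordinate of \<open>B\<close> is its entry at \<open>(a div N, a mod N)\<close>.\<close>

definition mat_unit :: "nat \<Rightarrow> nat \<Rightarrow> complex mat" where
  "mat_unit N a = mat N N (\<lambda>ij. if ij = (a div N, a mod N) then 1 else 0)"

definition op_mat :: "nat \<Rightarrow> (complex mat \<Rightarrow> complex mat) \<Rightarrow> complex mat" where
  "op_mat N F = mat (N * N) (N * N) (\<lambda>(a, b). F (mat_unit N b) $$ (a div N, a mod N))"

definition op_eigenvalues :: "nat \<Rightarrow> (complex mat \<Rightarrow> complex mat) \<Rightarrow> complex multiset" where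
  "op_eigenvalues N F = proots (char_poly (op_mat N F))"

text \<open>The eigenvalues of \<open>T\<^sup>*T\<close> are real and nonnegative (shown below), so taking real parts
  only changes the type.\<close>

definition singular_values :: "nat \<Rightarrow> (complex mat \<Rightarrow> complex mat) \<Rightarrow> real list" where
  "singular_values N T = rev (sorted_list_of_multiset
     (image_mset (\<lambda>z. sqrt (Re z)) (op_eigenvalues N (hs_adjoint N T \<circ> T))))"

text \<open>Counted from one, as usual: \<open>singular_value N T 1\<close> is the largest.\<close>

definition singular_value :: "nat \<Rightarrow> (complex mat \<Rightarrow> complex mat) \<Rightarrow> nat \<Rightarrow> real" where
  "singular_value N T k = singular_values N T ! (k - 1)"

definition mat_sum :: "nat \<Rightarrow> ('i \<Rightarrow> complex mat) \<Rightarrow> 'i set \<Rightarrow> complex mat" where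
  "mat_sum N f S = finsum (module_mat TYPE(complex) N N) f S"

definition kraus_map :: "nat \<Rightarrow> nat \<Rightarrow> (nat \<Rightarrow> complex mat) \<Rightarrow> complex mat \<Rightarrow> complex mat" where
  "kraus_map N d K M = mat_sum N (\<lambda>s. K s * M * mat_adjoint (K s)) {1..d}"


lemma mat_adjoint_dim [simp]:
  "dim_row (mat_adjoint A) = dim_col A" "dim_col (mat_adjoint A) = dim_row A"
  by (auto simp: mat_adjoint_def)

lemma mat_adjoint_index [simp]:
  "i < dim_col A \<Longrightarrow> j < dim_row A \<Longrightarrow> mat_adjoint A $$ (i, j) = cnj (A $$ (j, i))"
  by (auto simp: mat_adjoint_def mat_of_rows_def)

lemma hs_inner_sum:
  assumes "A \<in> carrier_mat N N" "B \<in> carrier_mat N N"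
  shows "hs_inner A B = (\<Sum>i<N. \<Sum>j<N. A $$ (i, j) * cnj (B $$ (i, j)))"
  using assms unfolding hs_inner_def mat_trace_def
  by (auto simp: scalar_prod_def lessThan_atLeast0 intro!: sum.cong)

lemma hs_inner_add_left:
  assumes "A \<in> carrier_mat N N" "A' \<in> carrier_mat N N" "B \<in> carrier_mat N N"
  shows "hs_inner (A + A') B = hs_inner A B + hs_inner A' B"
proof -
  have "A + A' \<in> carrier_mat N N" using assms by auto
  thus ?thesis using assms
    by (simp add: hs_inner_sum[where N = N] sum.distrib distrib_right)
qed

lemma hs_inner_smult_left:
  assumes "A \<in> carrier_mat N N" "B \<in> carrier_mat N N"
  shows "hs_inner (c \<cdot>\<^sub>m A) B = c * hs_inner A B"
proof -
  have "c \<cdot>\<^sub>m A \<in> carrier_mat N N" using assms by auto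
  thus ?thesis using assms
    by (simp add: hs_inner_sum[where N = N] sum_distrib_left mult.assoc)
qed

lemma hs_inner_cnj:
  assumes "A \<in> carrier_mat N N" "B \<in> carrier_mat N N"
  shows "hs_inner B A = cnj (hs_inner A B)"
  using assms by (simp add: hs_inner_sum[where N = N] mult.commute)

lemma hs_inner_self:
  assumes "A \<in> carrier_mat N N"
  shows "hs_inner A A = of_real (\<Sum>i<N. \<Sum>j<N. (cmod (A $$ (i, j)))\<^sup>2)"
  using assms by (simp add: hs_inner_sum[where N = N] complex_norm_square[symmetric])

lemma hs_inner_self_pos:
  assumes "A \<in> carrier_mat N N" "A \<noteq> 0\<^sub>m N N"
  shows "(\<Sum>i<N. \<Sum>j<N. (cmod (A $$ (i, j)))\<^sup>2) > 0"
proof -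
  obtain i j where ij: "i < N" "j < N" "A $$ (i, j) \<noteq> 0"
    using assms by (metis carrier_matD eq_matI index_zero_mat)
  have "0 < (cmod (A $$ (i, j)))\<^sup>2" using ij by simp
  also have "\<dots> \<le> (\<Sum>j<N. (cmod (A $$ (i, j)))\<^sup>2)"
    using ij by (intro member_le_sum) auto
  also have "\<dots> \<le> (\<Sum>i<N. \<Sum>j<N. (cmod (A $$ (i, j)))\<^sup>2)"
    using ij by (intro member_le_sum[where f = "\<lambda>i. \<Sum>j<N. (cmod (A $$ (i, j)))\<^sup>2"] sum_nonneg) auto
  finally show ?thesis .
qed

definition mat_linear :: "nat \<Rightarrow> (complex mat \<Rightarrow> complex mat) \<Rightarrow> bool" where
  "mat_linear N T \<longleftrightarrow> (\<forall>A\<in>carrier_mat N N. T A \<in> carrier_mat N N) \<and>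
     (\<forall>A\<in>carrier_mat N N. \<forall>B\<in>carrier_mat N N. T (A + B) = T A + T B) \<and>
     (\<forall>c. \<forall>A\<in>carrier_mat N N. T (c \<cdot>\<^sub>m A) = c \<cdot>\<^sub>m T A)"

abbreviation mat_unit2 :: "nat \<Rightarrow> nat \<times> nat \<Rightarrow> complex mat" where
  "mat_unit2 N p \<equiv> mat N N (\<lambda>ij. if ij = p then 1 else 0)"

lemma linear_functional_expand:
  fixes \<phi> :: "complex mat \<Rightarrow> complex"
  assumes add: "\<And>A B. A \<in> carrier_mat N N \<Longrightarrow> B \<in> carrier_mat N N \<Longrightarrow> \<phi> (A + B) = \<phi> A + \<phi> B"
    and smult: "\<And>c A. A \<in> carrier_mat N N \<Longrightarrow> \<phi> (c \<cdot>\<^sub>m A) = c * \<phi> A"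
    and A: "A \<in> carrier_mat N N"
  shows "\<phi> A = (\<Sum>i<N. \<Sum>j<N. A $$ (i, j) * \<phi> (mat_unit2 N (i, j)))"
proof -
  define R where "R S = mat N N (\<lambda>ij. if ij \<in> S then A $$ ij else 0)" for S
  have zero: "\<phi> (0\<^sub>m N N) = 0" using smult[of "0\<^sub>m N N" 0] by simp
  have "\<phi> (R S) = (\<Sum>p\<in>S. A $$ p * \<phi> (mat_unit2 N p))"
    if "finite S" "S \<subseteq> {..<N} \<times> {..<N}" for S
    using that
  proof (induction S rule: finite_induct)
    case empty
    have "R {} = 0\<^sub>m N N" by (rule eq_matI) (auto simp: R_def)
    thus ?case using zero by simp
  next
    case (insert p S)
    have "R (insert p S) = A $$ p \<cdot>\<^sub>m mat_unit2 N p + R S"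
      using insert by (intro eq_matI) (auto simp: R_def)
    moreover have "\<phi> (A $$ p \<cdot>\<^sub>m mat_unit2 N p + R S) = A $$ p * \<phi> (mat_unit2 N p) + \<phi> (R S)"
      by (subst add) (auto simp: R_def smult)
    ultimately show ?case using insert by simp
  qed
  from this[of "{..<N} \<times> {..<N}"] have "\<phi> (R ({..<N} \<times> {..<N})) =
      (\<Sum>p\<in>{..<N} \<times> {..<N}. A $$ p * \<phi> (mat_unit2 N p))" by simp
  moreover have "R ({..<N} \<times> {..<N}) = A" using A by (intro eq_matI) (auto simp: R_def)
  ultimately show ?thesis by (simp add: sum.cartesian_product)
qed

lemma hs_adjoint_exists:
  assumes T: "mat_linear N T" and B: "B \<in> carrier_mat N N"
  shows "\<exists>!C. C \<in> carrier_mat N N \<and> (\<forall>A\<in>carrier_mat N N. hs_inner (T A) B = hs_inner A C)"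
proof (rule ex_ex1I)
  have T': "\<And>A. A \<in> carrier_mat N N \<Longrightarrow> T A \<in> carrier_mat N N" using T by (auto simp: mat_linear_def)
  define C where "C = mat N N (\<lambda>ij. cnj (hs_inner (T (mat_unit2 N ij)) B))"
  have C: "C \<in> carrier_mat N N" by (simp add: C_def)
  have "hs_inner (T A) B = hs_inner A C" if A: "A \<in> carrier_mat N N" for A
  proof -
    have "hs_inner (T A) B =
        (\<Sum>i<N. \<Sum>j<N. A $$ (i, j) * hs_inner (T (mat_unit2 N (i, j))) B)"
      using T A B T' by (intro linear_functional_expand[where \<phi> = "\<lambda>A. hs_inner (T A) B"])
        (auto simp: mat_linear_def hs_inner_add_left[where N = N] hs_inner_smult_left[where N = N])
    also have "\<dots> = hs_inner A C" using A C by (simp add: hs_inner_sum[where A = A and N = N]) (simp add: C_def)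
    finally show ?thesis .
  qed
  with C show "\<exists>C. C \<in> carrier_mat N N \<and> (\<forall>A\<in>carrier_mat N N. hs_inner (T A) B = hs_inner A C)"
    by blast
next
  fix C D
  assume C: "C \<in> carrier_mat N N \<and> (\<forall>A\<in>carrier_mat N N. hs_inner (T A) B = hs_inner A C)"
    and D: "D \<in> carrier_mat N N \<and> (\<forall>A\<in>carrier_mat N N. hs_inner (T A) B = hs_inner A D)"
  have unit: "hs_inner (mat_unit2 N (i, j)) X = cnj (X $$ (i, j))"
    if "X \<in> carrier_mat N N" "i < N" "j < N" for X i j
  proof -
    have "hs_inner (mat_unit2 N (i, j)) X =
        (\<Sum>i'<N. \<Sum>j'<N. if j' = j then if i' = i then cnj (X $$ (i', j')) else 0 else 0)"
      unfolding hs_inner_sum[OF mat_carrier that(1)] by (intro sum.cong) auto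
    also have "\<dots> = cnj (X $$ (i, j))" using that by simp
    finally show ?thesis .
  qed
  show "C = D"
  proof (rule eq_matI)
    fix i j assume "i < dim_row D" "j < dim_col D"
    hence ij: "i < N" "j < N" using D by auto
    have "hs_inner (mat_unit2 N (i, j)) C = hs_inner (mat_unit2 N (i, j)) D"
      using C D by (metis mat_carrier)
    thus "C $$ (i, j) = D $$ (i, j)" using unit[of C] unit[of D] ij C D by auto
  qed (use C D in auto)
qed

lemma hs_adjoint:
  assumes "mat_linear N T" "B \<in> carrier_mat N N"
  shows "hs_adjoint N T B \<in> carrier_mat N N"
    and "A \<in> carrier_mat N N \<Longrightarrow> hs_inner (T A) B = hs_inner A (hs_adjoint N T B)"
  using theI'[OF hs_adjoint_exists[OF assms]] unfolding hs_adjoint_def by auto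

lemma length_singular_values: "length (singular_values N T) = N * N"
proof -
  have "op_mat N F \<in> carrier_mat (N * N) (N * N)" for F by (simp add: op_mat_def)
  from degree_monic_char_poly[OF this] show ?thesis
    by (simp add: singular_values_def op_eigenvalues_def size_proots_complex
        size_mset[symmetric] del: size_mset)
qed

lemma op_mat_mult_vec:
  assumes lin: "mat_linear N F" and v: "v \<in> carrier_vec (N * N)"
  shows "op_mat N F *\<^sub>v v =
    vec (N * N) (\<lambda>a. F (mat N N (\<lambda>(i, j). v $ (i * N + j))) $$ (a div N, a mod N))"
proof (rule eq_vecI)
  fix a assume "a < dim_vec (vec (N * N) (\<lambda>a. F (mat N N (\<lambda>(i, j). v $ (i * N + j))) $$ (a div N, a mod N)))"
  hence a: "a < N * N" by simp
  hence N: "N > 0" by (cases N) auto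
  have a': "a div N < N" "a mod N < N" using a N by (auto simp: less_mult_imp_div_less)
  let ?V = "mat N N (\<lambda>(i, j). v $ (i * N + j))"
  define \<phi> where "\<phi> X = F X $$ (a div N, a mod N)" for X
  have lin': "\<And>A. A \<in> carrier_mat N N \<Longrightarrow> F A \<in> carrier_mat N N"
     "\<And>A B. A \<in> carrier_mat N N \<Longrightarrow> B \<in> carrier_mat N N \<Longrightarrow> F (A + B) = F A + F B"
     "\<And>c A. A \<in> carrier_mat N N \<Longrightarrow> F (c \<cdot>\<^sub>m A) = c \<cdot>\<^sub>m F A"
    using lin by (auto simp: mat_linear_def)
  have "(op_mat N F *\<^sub>v v) $ a = (\<Sum>b<N * N. \<phi> (mat_unit N b) * v $ b)"
    using a v by (auto simp: op_mat_def scalar_prod_def lessThan_atLeast0 \<phi>_def intro!: sum.cong)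
  also have "\<dots> = (\<Sum>i<N. \<Sum>j<N. \<phi> (mat_unit2 N (i, j)) * v $ (i * N + j))"
  proof -
    have "(\<Sum>b<N * N. \<phi> (mat_unit N b) * v $ b) =
        (\<Sum>(i, j)\<in>{..<N} \<times> {..<N}. \<phi> (mat_unit2 N (i, j)) * v $ (i * N + j))"
    proof (rule sum.reindex_bij_witness[where i = "\<lambda>(i, j). i * N + j" and j = "\<lambda>b. (b div N, b mod N)"])
      fix b assume "b \<in> {..<N * N}"
      thus "(b div N, b mod N) \<in> {..<N} \<times> {..<N}" using N by (auto simp: less_mult_imp_div_less)
    next
      fix p assume "p \<in> {..<N} \<times> {..<N}"
      then obtain i j where p: "p = (i, j)" "i < N" "j < N" by auto
      have "i * N + j < Suc i * N" using p by simp
      also have "\<dots> \<le> N * N" using p by (intro mult_right_mono) auto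
      finally show "(case p of (i, j) \<Rightarrow> i * N + j) \<in> {..<N * N}" using p by simp
    qed (auto simp: mat_unit_def)
    thus ?thesis by (simp add: sum.cartesian_product)
  qed
  also have "\<dots> = \<phi> ?V"
  proof (subst linear_functional_expand[of N \<phi> ?V])
    show "\<phi> (A + B) = \<phi> A + \<phi> B" if "A \<in> carrier_mat N N" "B \<in> carrier_mat N N" for A B
      using that a' lin'(1)[of A] lin'(1)[of B] by (simp add: \<phi>_def lin'(2))
    show "\<phi> (c \<cdot>\<^sub>m A) = c * \<phi> A" if "A \<in> carrier_mat N N" for c A
      using that a' lin'(1)[of A] by (simp add: \<phi>_def lin'(3))
  qed (auto simp: mult.commute intro!: sum.cong)
  finally show "(op_mat N F *\<^sub>v v) $ a = vec (N * N) (\<lambda>a. F ?V $$ (a div N, a mod N)) $ a"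
    using a by (simp add: \<phi>_def)
qed (simp add: op_mat_def)

lemma mat_linear_hs_adjoint:
  assumes T: "mat_linear N T"
  shows "mat_linear N (hs_adjoint N T)"
proof -
  have T': "\<And>A. A \<in> carrier_mat N N \<Longrightarrow> T A \<in> carrier_mat N N" using T by (auto simp: mat_linear_def)
  have char: "hs_adjoint N T B = C"
    if "B \<in> carrier_mat N N" "C \<in> carrier_mat N N"
      "\<And>A. A \<in> carrier_mat N N \<Longrightarrow> hs_inner (T A) B = hs_inner A C" for B C
    unfolding hs_adjoint_def using hs_adjoint_exists[OF T that(1)] that by (intro the1_equality) auto
  note adj = hs_adjoint[OF T]
  have cnj_swap: "hs_inner X Y = cnj (hs_inner Y X)"
    if "X \<in> carrier_mat N N" "Y \<in> carrier_mat N N" for X Y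
    using hs_inner_cnj that by blast
  have "hs_adjoint N T (B + C) = hs_adjoint N T B + hs_adjoint N T C"
    if B: "B \<in> carrier_mat N N" and C: "C \<in> carrier_mat N N" for B C
  proof (rule char)
    fix A :: "complex mat" assume A: "A \<in> carrier_mat N N"
    show "hs_inner (T A) (B + C) = hs_inner A (hs_adjoint N T B + hs_adjoint N T C)"
      using A B C adj(1)[OF B] adj(1)[OF C] T'[OF A] adj(2)[OF B A] adj(2)[OF C A]
      by (simp add: cnj_swap[of _ "_ + _"] hs_inner_add_left[where N = N])
        (metis cnj_swap)
  qed (use B C adj in auto)
  moreover have "hs_adjoint N T (c \<cdot>\<^sub>m B) = c \<cdot>\<^sub>m hs_adjoint N T B"
    if B: "B \<in> carrier_mat N N" for B c
  proof (rule char)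
    fix A :: "complex mat" assume A: "A \<in> carrier_mat N N"
    show "hs_inner (T A) (c \<cdot>\<^sub>m B) = hs_inner A (c \<cdot>\<^sub>m hs_adjoint N T B)"
      using A B adj(1)[OF B] T'[OF A] adj(2)[OF B A]
      by (simp add: cnj_swap[of _ "_ \<cdot>\<^sub>m _"] hs_inner_smult_left[where N = N])
        (metis cnj_swap)
  qed (use B adj in auto)
  ultimately show ?thesis using adj unfolding mat_linear_def by auto
qed

lemma op_eigenvalues_nonneg:
  assumes T: "mat_linear N T" and z: "z \<in># op_eigenvalues N (hs_adjoint N T \<circ> T)"
  shows "z \<in> \<real>" and "Re z \<ge> 0"
proof -
  let ?F = "hs_adjoint N T \<circ> T"
  have F: "mat_linear N ?F"
    using T mat_linear_hs_adjoint[OF T] by (auto simp: mat_linear_def)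
  have M: "op_mat N ?F \<in> carrier_mat (N * N) (N * N)" by (simp add: op_mat_def)
  have "char_poly (op_mat N ?F) \<noteq> 0" using degree_monic_char_poly[OF M] by auto
  hence "eigenvalue (op_mat N ?F) z"
    using z eigenvalue_root_char_poly[OF M] by (simp add: op_eigenvalues_def)
  then obtain v where v: "v \<in> carrier_vec (N * N)" "v \<noteq> 0\<^sub>v (N * N)"
      "op_mat N ?F *\<^sub>v v = z \<cdot>\<^sub>v v"
    using M by (auto simp: eigenvalue_def eigenvector_def)
  define V where "V = mat N N (\<lambda>(i, j). v $ (i * N + j))"
  have V: "V \<in> carrier_mat N N" by (simp add: V_def)
  have TV: "T V \<in> carrier_mat N N" using T V by (auto simp: mat_linear_def)
  have FV: "?F V \<in> carrier_mat N N" using F V unfolding mat_linear_def by blast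
  have lt: "i * N + j < N * N" if "i < N" "j < N" for i j
  proof -
    have "i * N + j < Suc i * N" using that by simp
    also have "\<dots> \<le> N * N" using that by (intro mult_right_mono) auto
    finally show ?thesis .
  qed
  have "?F V = z \<cdot>\<^sub>m V"
  proof (rule eq_matI)
    fix i j assume "i < dim_row (z \<cdot>\<^sub>m V)" "j < dim_col (z \<cdot>\<^sub>m V)"
    hence ij: "i < N" "j < N" using V by auto
    have "(op_mat N ?F *\<^sub>v v) $ (i * N + j) = ?F V $$ (i, j)"
      using lt[OF ij] ij by (simp add: op_mat_mult_vec[OF F v(1)] V_def)
    thus "?F V $$ (i, j) = (z \<cdot>\<^sub>m V) $$ (i, j)"
      using v(1) lt[OF ij] ij by (simp add: v(3) V_def)
  qed (use FV V in auto)
  hence eq: "hs_inner (T V) (T V) = cnj z * hs_inner V V"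
    using hs_adjoint(2)[OF T TV V] V TV hs_inner_cnj[of "z \<cdot>\<^sub>m V" N V]
    by (simp add: hs_inner_smult_left[where N = N] hs_inner_cnj[of V N V, symmetric])
  have "V \<noteq> 0\<^sub>m N N"
  proof
    assume 0: "V = 0\<^sub>m N N"
    have "v = 0\<^sub>v (N * N)"
    proof (rule eq_vecI)
      fix a assume "a < dim_vec (0\<^sub>v (N * N) :: complex vec)"
      hence a: "a < N * N" by simp
      hence "N > 0" by (cases N) auto
      hence a': "a div N < N" "a mod N < N" using a by (auto simp: less_mult_imp_div_less)
      have "V $$ (a div N, a mod N) = 0" using a' by (simp add: 0)
      thus "v $ a = 0\<^sub>v (N * N) $ a" using a a' by (simp add: V_def)
    qed (use v in auto)
    with v show False by simp
  qed
  from hs_inner_self_pos[OF V this] obtain r where r: "r > 0" "hs_inner V V = of_real r"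
    using hs_inner_self[OF V] by blast
  obtain t where t: "t \<ge> 0" "hs_inner (T V) (T V) = of_real t"
    using hs_inner_self[OF TV] by (meson sum_nonneg zero_le_power2)
  have "cnj z = of_real (t / r)" using eq r t by (simp add: field_simps)
  hence "z = of_real (t / r)" by (metis complex_cnj_cnj complex_cnj_complex_of_real)
  thus "z \<in> \<real>" "Re z \<ge> 0" using r t by auto
qed

end

theory Submission
  imports Defs "HOL-Analysis.Convex"
begin

text \<open>
  A trace-preserving map \<open>T(M) = \<Sum>\<^sub>w L(w) M L(w)\<^sup>*\<close> with \<open>D\<close> Kraus operators has a large
  Hilbert--Schmidt norm but only a moderate operator norm, so its Hilbert--Schmidt norm cannot be
  carried by the top singular value alone.

  In the basis of matrix units \<open>T\<close> has entries \<open>\<Sum>\<^sub>w L(w)\<^sub>i\<^sub>k cnj L(w)\<^sub>j\<^sub>l\<close>. Hence the sum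
  \<open>\<Sum> s\<^sub>i\<^sup>2\<close> of the squared singular values is the sum of \<open>\<bar>(L(w), L(v))\<bar>\<^sup>2\<close> over all pairs
  \<open>w\<close>, \<open>v\<close>. The diagonal pairs alone contribute at least \<open>N\<^sup>2/D\<close> by Cauchy--Schwarz, because the
  normalisation \<open>\<Sum>\<^sub>w L(w)\<^sup>*L(w) = 1\<close> forces \<open>\<Sum>\<^sub>w (L(w), L(w)) = N\<close>
  (\<open>kraus_sum_norm2_units_ge\<close>).
  The same normalisation says \<open>\<Sum>\<^sub>w \<parallel>L(w) M\<parallel>\<^sup>2 = \<parallel>M\<parallel>\<^sup>2\<close>, so that \<open>\<parallel>T(M)\<parallel>\<^sup>2 \<le> D \<parallel>M\<parallel>\<^sup>2\<close> and
  \<open>s\<^sub>1\<^sup>2 \<le> D\<close> (\<open>kraus_norm2_le\<close>). The remaining \<open>N\<^sup>2 - 1\<close> singular values are at most \<open>s\<^sub>2\<close>, so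
  \<open>(N\<^sup>2 - 1) s\<^sub>2\<^sup>2 \<ge> N\<^sup>2/D - D\<close>, and as soon as \<open>D\<^sup>2 \<le> N\<close> this gives
  \<open>s\<^sub>2 \<ge> exp (- 1/(2N)) / sqrt D\<close> (\<open>kraus_second_singular_value_ge\<close>).

  This applies to the \<open>m\<close>-th power of the given map: its Kraus operators are the products along
  words of length \<open>m\<close>, so \<open>D = d ^ m\<close> (\<open>kraus_decomposition_funpow\<close>), and \<open>m\<close> is chosen such that
  \<open>D ^ 4 \<le> N\<close>. Taking \<open>m\<close>-th roots only improves the exponential factor.
\<close>

section \<open>Sums and adjoints of matrices\<close>

lemma mat_sum_empty [simp]: "mat_sum N f {} = 0\<^sub>m N N"
proof -
  interpret abelian_group "module_mat TYPE(complex) N N" by (rule abelian_group_mat)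
  show ?thesis by (simp add: mat_sum_def module_mat_simps)
qed

lemma mat_sum_insert:
  assumes "finite S" "x \<notin> S" "f x \<in> carrier_mat N N" "\<And>y. y \<in> S \<Longrightarrow> f y \<in> carrier_mat N N"
  shows "mat_sum N f (insert x S) = f x + mat_sum N f S"
proof -
  interpret abelian_group "module_mat TYPE(complex) N N" by (rule abelian_group_mat)
  show ?thesis using assms
    by (auto simp: mat_sum_def module_mat_simps Pi_def finsum_insert)
qed

lemma mat_sum_carrier:
  assumes "finite S" "\<And>x. x \<in> S \<Longrightarrow> f x \<in> carrier_mat N N"
  shows "mat_sum N f S \<in> carrier_mat N N"
  using assms by (induction S rule: finite_induct) (auto simp: mat_sum_insert)

lemma mat_sum_index:
  assumes "finite S" "\<And>x. x \<in> S \<Longrightarrow> f x \<in> carrier_mat N N" "i < N" "j < N"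
  shows "mat_sum N f S $$ (i, j) = (\<Sum>x\<in>S. f x $$ (i, j))"
  using assms
proof (induction S rule: finite_induct)
  case (insert x S)
  have "mat_sum N f S \<in> carrier_mat N N" "f x \<in> carrier_mat N N"
    using insert by (auto intro: mat_sum_carrier)
  thus ?case using insert by (auto simp: mat_sum_insert)
qed auto

lemma mat_sum_cong:
  assumes "finite S" "\<And>x. x \<in> S \<Longrightarrow> f x = g x" "\<And>x. x \<in> S \<Longrightarrow> g x \<in> carrier_mat N N"
  shows "mat_sum N f S = mat_sum N g S"
proof (rule eq_matI)
  have "mat_sum N f S \<in> carrier_mat N N" "mat_sum N g S \<in> carrier_mat N N"
    using assms by (auto intro!: mat_sum_carrier)
  thus "dim_row (mat_sum N f S) = dim_row (mat_sum N g S)"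
    "dim_col (mat_sum N f S) = dim_col (mat_sum N g S)"
    "\<And>i j. i < dim_row (mat_sum N g S) \<Longrightarrow> j < dim_col (mat_sum N g S) \<Longrightarrow>
      mat_sum N f S $$ (i, j) = mat_sum N g S $$ (i, j)"
    using assms by (auto simp: mat_sum_index)
qed

lemma mat_sum_reindex_bij:
  assumes "finite S" "bij_betw h R S" "\<And>x. x \<in> S \<Longrightarrow> f x \<in> carrier_mat N N"
  shows "mat_sum N (\<lambda>x. f (h x)) R = mat_sum N f S"
proof (rule eq_matI)
  have R: "finite R" "\<And>x. x \<in> R \<Longrightarrow> h x \<in> S"
    using assms bij_betw_finite bij_betwE by blast+
  have "mat_sum N (\<lambda>x. f (h x)) R \<in> carrier_mat N N" "mat_sum N f S \<in> carrier_mat N N"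
    using assms R by (auto intro!: mat_sum_carrier)
  thus "dim_row (mat_sum N (\<lambda>x. f (h x)) R) = dim_row (mat_sum N f S)"
    "dim_col (mat_sum N (\<lambda>x. f (h x)) R) = dim_col (mat_sum N f S)"
    "\<And>i j. i < dim_row (mat_sum N f S) \<Longrightarrow> j < dim_col (mat_sum N f S) \<Longrightarrow>
      mat_sum N (\<lambda>x. f (h x)) R $$ (i, j) = mat_sum N f S $$ (i, j)"
    using assms R by (auto simp: mat_sum_index sum.reindex_bij_betw[OF assms(2), where g = "\<lambda>x. f x $$ _"])
qed

lemma mat_sum_mat_sum:
  assumes "finite S" "finite R" "\<And>x y. x \<in> S \<Longrightarrow> y \<in> R \<Longrightarrow> f x y \<in> carrier_mat N N"
  shows "mat_sum N (\<lambda>x. mat_sum N (f x) R) S = mat_sum N (\<lambda>(x, y). f x y) (S \<times> R)"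
proof (rule eq_matI)
  have inner: "\<And>x. x \<in> S \<Longrightarrow> mat_sum N (f x) R \<in> carrier_mat N N"
    using assms by (auto intro!: mat_sum_carrier)
  have "mat_sum N (\<lambda>x. mat_sum N (f x) R) S \<in> carrier_mat N N"
    "mat_sum N (\<lambda>(x, y). f x y) (S \<times> R) \<in> carrier_mat N N"
    using assms inner by (auto intro!: mat_sum_carrier)
  moreover have "mat_sum N (\<lambda>(x, y). f x y) (S \<times> R) $$ (i, j) = (\<Sum>(x, y)\<in>S \<times> R. f x y $$ (i, j))"
    if "i < N" "j < N" for i j
    using assms that by (subst mat_sum_index) (auto simp: case_prod_unfold)
  ultimately show "dim_row (mat_sum N (\<lambda>x. mat_sum N (f x) R) S) = dim_row (mat_sum N (\<lambda>(x, y). f x y) (S \<times> R))"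
    "dim_col (mat_sum N (\<lambda>x. mat_sum N (f x) R) S) = dim_col (mat_sum N (\<lambda>(x, y). f x y) (S \<times> R))"
    "\<And>i j. i < dim_row (mat_sum N (\<lambda>(x, y). f x y) (S \<times> R)) \<Longrightarrow>
      j < dim_col (mat_sum N (\<lambda>(x, y). f x y) (S \<times> R)) \<Longrightarrow>
      mat_sum N (\<lambda>x. mat_sum N (f x) R) S $$ (i, j) = mat_sum N (\<lambda>(x, y). f x y) (S \<times> R) $$ (i, j)"
    using assms inner by (auto simp: mat_sum_index sum.cartesian_product)
qed

lemma mat_sum_swap:
  assumes "finite S" "finite R" "\<And>x y. x \<in> S \<Longrightarrow> y \<in> R \<Longrightarrow> f x y \<in> carrier_mat N N"
  shows "mat_sum N (\<lambda>(x, y). f x y) (S \<times> R) = mat_sum N (\<lambda>(y, x). f x y) (R \<times> S)"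
proof -
  have "bij_betw (\<lambda>(x, y). (y, x)) (S \<times> R) (R \<times> S)"
    by (rule bij_betwI[where g = "\<lambda>(y, x). (x, y)"]) auto
  from mat_sum_reindex_bij[OF _ this, of "\<lambda>(y, x). f x y" N] show ?thesis
    using assms by (auto simp: case_prod_unfold)
qed

lemma additive_mat_sum:
  assumes add: "\<And>A B. A \<in> carrier_mat N N \<Longrightarrow> B \<in> carrier_mat N N \<Longrightarrow> g (A + B) = g A + g B"
    and zero: "g (0\<^sub>m N N) = 0\<^sub>m N N"
    and g: "\<And>A. A \<in> carrier_mat N N \<Longrightarrow> g A \<in> carrier_mat N N"
    and "finite S" "\<And>x. x \<in> S \<Longrightarrow> f x \<in> carrier_mat N N"
  shows "g (mat_sum N f S) = mat_sum N (\<lambda>x. g (f x)) S"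
  using assms(4,5)
  by (induction S rule: finite_induct) (auto simp: zero mat_sum_insert add g mat_sum_carrier)

lemma mult_mat_sum_mult:
  assumes "A \<in> carrier_mat N N" "B \<in> carrier_mat N N"
    and "finite S" "\<And>x. x \<in> S \<Longrightarrow> f x \<in> carrier_mat N N"
  shows "A * mat_sum N f S * B = mat_sum N (\<lambda>x. A * f x * B) S"
  using assms
  by (intro additive_mat_sum[where g = "\<lambda>X. A * X * B"])
    (auto simp: mult_add_distrib_mat[where nr = N and n = N and nc = N]
      add_mult_distrib_mat[where nr = N and n = N and nc = N])

lemma mat_sum_add:
  assumes "finite S" "\<And>x. x \<in> S \<Longrightarrow> f x \<in> carrier_mat N N" "\<And>x. x \<in> S \<Longrightarrow> g x \<in> carrier_mat N N"
  shows "mat_sum N (\<lambda>x. f x + g x) S = mat_sum N f S + mat_sum N g S"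
proof (rule eq_matI)
  have "mat_sum N f S \<in> carrier_mat N N" "mat_sum N g S \<in> carrier_mat N N"
    "mat_sum N (\<lambda>x. f x + g x) S \<in> carrier_mat N N"
    using assms by (auto intro!: mat_sum_carrier)
  moreover have "(f x + g x) $$ (i, j) = f x $$ (i, j) + g x $$ (i, j)" if "x \<in> S" "i < N" "j < N" for x i j
    using assms(2,3)[OF that(1)] that by auto
  ultimately show "dim_row (mat_sum N (\<lambda>x. f x + g x) S) = dim_row (mat_sum N f S + mat_sum N g S)"
    "dim_col (mat_sum N (\<lambda>x. f x + g x) S) = dim_col (mat_sum N f S + mat_sum N g S)"
    "\<And>i j. i < dim_row (mat_sum N f S + mat_sum N g S) \<Longrightarrow> j < dim_col (mat_sum N f S + mat_sum N g S) \<Longrightarrow>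
      mat_sum N (\<lambda>x. f x + g x) S $$ (i, j) = (mat_sum N f S + mat_sum N g S) $$ (i, j)"
    using assms by (auto simp: mat_sum_index sum.distrib)
qed

lemma mat_adjoint_carrier [simp]: "A \<in> carrier_mat N N \<Longrightarrow> mat_adjoint A \<in> carrier_mat N N"
  by (rule carrier_matI) (simp_all only: mat_adjoint_dim carrier_matD)

lemma mult_square_carrier [simp]:
  "A \<in> carrier_mat N N \<Longrightarrow> B \<in> carrier_mat N N \<Longrightarrow> A * B \<in> carrier_mat N N"
  by (rule mult_carrier_mat)

lemma mult_square_index:
  "A \<in> carrier_mat N N \<Longrightarrow> B \<in> carrier_mat N N \<Longrightarrow> i < N \<Longrightarrow> j < N \<Longrightarrow>
    (A * B) $$ (i, j) = (\<Sum>k<N. A $$ (i, k) * B $$ (k, j))"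
  by (simp add: scalar_prod_def lessThan_atLeast0)

lemma mat_adjoint_adjoint: "mat_adjoint (mat_adjoint A) = (A :: complex mat)"
  by (rule eq_matI) simp_all

lemma mat_adjoint_one: "mat_adjoint (1\<^sub>m N) = (1\<^sub>m N :: complex mat)"
  by (rule eq_matI) auto

lemma mat_adjoint_mult:
  assumes "A \<in> carrier_mat N N" "B \<in> carrier_mat N N"
  shows "mat_adjoint (A * B) = mat_adjoint B * (mat_adjoint A :: complex mat)"
  using assms by (intro eq_matI) (auto simp: scalar_prod_def mult.commute)

section \<open>The Hilbert--Schmidt norm\<close>

definition hs_norm2 :: "nat \<Rightarrow> complex mat \<Rightarrow> real" where
  "hs_norm2 N A = (\<Sum>i<N. \<Sum>j<N. (cmod (A $$ (i, j)))\<^sup>2)"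

lemma hs_norm2_nonneg: "hs_norm2 N A \<ge> 0"
  by (auto simp: hs_norm2_def intro!: sum_nonneg)

lemma hs_inner_norm2: "A \<in> carrier_mat N N \<Longrightarrow> hs_inner A A = of_real (hs_norm2 N A)"
  by (simp add: hs_inner_self hs_norm2_def)

lemma hs_norm2_adjoint:
  assumes "A \<in> carrier_mat N N"
  shows "hs_norm2 N (mat_adjoint A) = hs_norm2 N A"
  unfolding hs_norm2_def using assms by (subst sum.swap) simp

lemma mat_trace_commute:
  assumes "A \<in> carrier_mat n k" "B \<in> carrier_mat k n"
  shows "mat_trace (A * B) = mat_trace (B * A)"
proof -
  have "mat_trace (A * B) = (\<Sum>i<n. \<Sum>j<k. A $$ (i, j) * B $$ (j, i))"
    using assms by (auto simp: mat_trace_def scalar_prod_def lessThan_atLeast0 intro!: sum.cong)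
  also have "\<dots> = mat_trace (B * A)"
    using assms
    by (subst sum.swap)
      (auto simp: mat_trace_def scalar_prod_def lessThan_atLeast0 mult.commute intro!: sum.cong)
  finally show ?thesis .
qed

lemma hs_inner_mult_left:
  assumes "A \<in> carrier_mat N N" "X \<in> carrier_mat N N" "Y \<in> carrier_mat N N"
  shows "hs_inner (A * X) Y = hs_inner X (mat_adjoint A * Y)"
proof -
  note c = assms assms[THEN mat_adjoint_carrier]
  have "hs_inner (A * X) Y = mat_trace (A * (X * mat_adjoint Y))"
    unfolding hs_inner_def using c by (subst assoc_mult_mat) auto
  also have "\<dots> = mat_trace (X * mat_adjoint Y * A)"
    using c by (intro mat_trace_commute) auto
  also have "\<dots> = hs_inner X (mat_adjoint A * Y)"
    unfolding hs_inner_def using c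
    by (subst assoc_mult_mat) (auto simp: mat_adjoint_mult[where N = N] mat_adjoint_adjoint)
  finally show ?thesis .
qed

lemma hs_inner_mat_sum_left:
  assumes "finite S" "\<And>x. x \<in> S \<Longrightarrow> f x \<in> carrier_mat N N" "B \<in> carrier_mat N N"
  shows "hs_inner (mat_sum N f S) B = (\<Sum>x\<in>S. hs_inner (f x) B)"
  using assms
proof (induction S rule: finite_induct)
  case empty
  thus ?case by (simp add: hs_inner_sum[where N = N])
next
  case (insert x S)
  have "mat_sum N f S \<in> carrier_mat N N" using insert by (auto intro: mat_sum_carrier)
  thus ?case using insert by (auto simp: mat_sum_insert hs_inner_add_left[where N = N])
qed

lemma norm_sum_squared_le:
  fixes f :: "'a \<Rightarrow> 'b :: real_normed_vector"
  assumes "finite S"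
  shows "(norm (\<Sum>x\<in>S. f x))\<^sup>2 \<le> real (card S) * (\<Sum>x\<in>S. (norm (f x))\<^sup>2)"
proof -
  have "(norm (\<Sum>x\<in>S. f x))\<^sup>2 \<le> (\<Sum>x\<in>S. norm (f x))\<^sup>2"
    by (intro power_mono norm_sum) auto
  also have "\<dots> \<le> (\<Sum>x\<in>S. (norm (f x))\<^sup>2) * card S"
    by (rule sum_squared_le_sum_of_squares)
  finally show ?thesis by (simp add: mult.commute)
qed

lemma hs_norm2_mat_sum_le:
  assumes "finite S" "\<And>x. x \<in> S \<Longrightarrow> f x \<in> carrier_mat N N"
  shows "hs_norm2 N (mat_sum N f S) \<le> real (card S) * (\<Sum>x\<in>S. hs_norm2 N (f x))"
proof -
  have "hs_norm2 N (mat_sum N f S) \<le>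
      (\<Sum>i<N. \<Sum>j<N. real (card S) * (\<Sum>x\<in>S. (cmod (f x $$ (i, j)))\<^sup>2))"
    unfolding hs_norm2_def using assms
    by (intro sum_mono) (simp add: mat_sum_index norm_sum_squared_le)
  also have "\<dots> = real (card S) * (\<Sum>x\<in>S. hs_norm2 N (f x))"
  proof -
    have "(\<Sum>x\<in>S. hs_norm2 N (f x)) = (\<Sum>i<N. \<Sum>j<N. \<Sum>x\<in>S. (cmod (f x $$ (i, j)))\<^sup>2)"
      unfolding hs_norm2_def by (subst sum.swap) (intro sum.cong refl, rule sum.swap)
    thus ?thesis by (simp add: sum_distrib_left)
  qed
  finally show ?thesis .
qed

section \<open>Kraus decompositions\<close>

text \<open>The index set is arbitrary, so that the index sets \<open>V \<times> W\<close> of compositions and the sets of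
  words indexing powers are covered. Only the values of \<open>T\<close> on \<open>N \<times> N\<close> matrices are constrained:
  elsewhere the right-hand side is unspecified and need not agree with, say, \<open>T ^^ 0\<close>.\<close>

definition kraus_decomposition ::
    "nat \<Rightarrow> 'i set \<Rightarrow> ('i \<Rightarrow> complex mat) \<Rightarrow> (complex mat \<Rightarrow> complex mat) \<Rightarrow> bool" where
  "kraus_decomposition N W L T \<longleftrightarrow> finite W \<and> (\<forall>w\<in>W. L w \<in> carrier_mat N N) \<and>
     mat_sum N (\<lambda>w. mat_adjoint (L w) * L w) W = 1\<^sub>m N \<and>
     (\<forall>M\<in>carrier_mat N N. T M = mat_sum N (\<lambda>w. L w * M * mat_adjoint (L w)) W)"

lemma kraus_decompositionD:
  assumes "kraus_decomposition N W L T"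
  shows "finite W" "\<And>w. w \<in> W \<Longrightarrow> L w \<in> carrier_mat N N"
    "\<And>w. w \<in> W \<Longrightarrow> mat_adjoint (L w) \<in> carrier_mat N N"
    "mat_sum N (\<lambda>w. mat_adjoint (L w) * L w) W = 1\<^sub>m N"
    "\<And>M. M \<in> carrier_mat N N \<Longrightarrow> T M = mat_sum N (\<lambda>w. L w * M * mat_adjoint (L w)) W"
  using assms by (auto simp: kraus_decomposition_def)

lemma kraus_decomposition_linear:
  assumes "kraus_decomposition N W L T"
  shows "mat_linear N T"
proof -
  note K = kraus_decompositionD[OF assms]
  have c: "\<And>w M. w \<in> W \<Longrightarrow> M \<in> carrier_mat N N \<Longrightarrow> L w * M * mat_adjoint (L w) \<in> carrier_mat N N"
    using K(2,3) by auto
  have T: "T A \<in> carrier_mat N N" if "A \<in> carrier_mat N N" for A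
    using that K(1) c by (simp add: K(5) mat_sum_carrier)
  moreover have "T (A + B) = T A + T B" if A: "A \<in> carrier_mat N N" and B: "B \<in> carrier_mat N N" for A B
  proof -
    have "L w * (A + B) * mat_adjoint (L w) = L w * A * mat_adjoint (L w) + L w * B * mat_adjoint (L w)"
      if "w \<in> W" for w
      using K(2,3)[OF that] A B
      by (simp add: mult_add_distrib_mat[where nr = N and n = N and nc = N]
          add_mult_distrib_mat[where nr = N and n = N and nc = N])
    hence "T (A + B) = mat_sum N (\<lambda>w. L w * A * mat_adjoint (L w) + L w * B * mat_adjoint (L w)) W"
      using A B K(1) c by (simp add: K(5)) (rule mat_sum_cong, auto)
    thus ?thesis using A B K(1) c by (simp add: K(5) mat_sum_add)
  qed
  moreover have "T (a \<cdot>\<^sub>m A) = a \<cdot>\<^sub>m T A" if A: "A \<in> carrier_mat N N" for a A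
  proof -
    have "L w * (a \<cdot>\<^sub>m A) * mat_adjoint (L w) = a \<cdot>\<^sub>m (L w * A * mat_adjoint (L w))" if "w \<in> W" for w
      using K(2,3)[OF that] A
      by (simp add: mult_smult_distrib[where nr = N and n = N and nc = N]
          mult_smult_assoc_mat[where nr = N and n = N and nc = N])
    hence "T (a \<cdot>\<^sub>m A) = mat_sum N (\<lambda>w. a \<cdot>\<^sub>m (L w * A * mat_adjoint (L w))) W"
      using A K(1) c by (simp add: K(5)) (rule mat_sum_cong, auto)
    also have "\<dots> = a \<cdot>\<^sub>m mat_sum N (\<lambda>w. L w * A * mat_adjoint (L w)) W"
      using A K(1) c
      by (intro additive_mat_sum[where g = "\<lambda>X. a \<cdot>\<^sub>m X", symmetric])
        (auto simp: add_smult_distrib_left_mat[where nr = N and nc = N])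
    finally show ?thesis using A by (simp add: K(5))
  qed
  ultimately show ?thesis by (auto simp: mat_linear_def)
qed

lemma kraus_decomposition_id:
  "kraus_decomposition N {x} (\<lambda>_. 1\<^sub>m N) id"
  by (auto simp: kraus_decomposition_def mat_sum_insert mat_adjoint_one)

text \<open>Summing \<open>B\<^sup>*A\<^sup>*AB\<close> over the index of \<open>A\<close> first collapses the middle factor to the identity;
  this is why the pairs are reordered before the normalisation is checked.\<close>

lemma kraus_decomposition_comp:
  assumes "kraus_decomposition N V A S" "kraus_decomposition N W B T"
  shows "kraus_decomposition N (V \<times> W) (\<lambda>(v, w). A v * B w) (S \<circ> T)"
proof -
  note A = kraus_decompositionD[OF assms(1)] and B = kraus_decompositionD[OF assms(2)]
  note assoc = assoc_mult_mat[where ?n\<^sub>1.0 = N and ?n\<^sub>2.0 = N and ?n\<^sub>3.0 = N and ?n\<^sub>4.0 = N]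
  note adj = mat_adjoint_mult[where N = N]
  have "mat_sum N (\<lambda>(v, w). mat_adjoint (A v * B w) * (A v * B w)) (V \<times> W) =
      mat_sum N (\<lambda>(w, v). mat_adjoint (A v * B w) * (A v * B w)) (W \<times> V)"
    using A B by (intro mat_sum_swap) auto
  also have "\<dots> = mat_sum N (\<lambda>w. mat_sum N (\<lambda>v. mat_adjoint (A v * B w) * (A v * B w)) V) W"
    using A B by (intro mat_sum_mat_sum[symmetric]) auto
  also have "\<dots> = mat_sum N (\<lambda>w. mat_adjoint (B w) * B w) W"
  proof (intro mat_sum_cong)
    fix w assume w: "w \<in> W"
    have "mat_sum N (\<lambda>v. mat_adjoint (A v * B w) * (A v * B w)) V =
        mat_sum N (\<lambda>v. mat_adjoint (B w) * (mat_adjoint (A v) * A v) * B w) V"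
    proof (intro mat_sum_cong)
      fix v assume v: "v \<in> V"
      have c: "A v * B w \<in> carrier_mat N N" "mat_adjoint (A v) * A v \<in> carrier_mat N N"
        "A v \<in> carrier_mat N N" "mat_adjoint (A v) \<in> carrier_mat N N"
        "B w \<in> carrier_mat N N" "mat_adjoint (B w) \<in> carrier_mat N N"
        using A(2,3)[OF v] B(2,3)[OF w] by auto
      show "mat_adjoint (A v * B w) * (A v * B w) = mat_adjoint (B w) * (mat_adjoint (A v) * A v) * B w"
        using c by (simp add: adj assoc)
      show "mat_adjoint (B w) * (mat_adjoint (A v) * A v) * B w \<in> carrier_mat N N"
        using c by auto
    qed (rule A)
    also have "\<dots> = mat_adjoint (B w) * mat_sum N (\<lambda>v. mat_adjoint (A v) * A v) V * B w"
      using A B w by (intro mult_mat_sum_mult[symmetric]) auto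
    also have "\<dots> = mat_adjoint (B w) * B w" using B(3)[OF w] A(4) by (simp add: right_mult_one_mat[of _ N])
    finally show "mat_sum N (\<lambda>v. mat_adjoint (A v * B w) * (A v * B w)) V = mat_adjoint (B w) * B w" .
  qed (use B in auto)
  finally have unital:
    "mat_sum N (\<lambda>(v, w). mat_adjoint (A v * B w) * (A v * B w)) (V \<times> W) = 1\<^sub>m N"
    using B(4) by simp
  have "(S \<circ> T) M = mat_sum N (\<lambda>(v, w). (A v * B w) * M * mat_adjoint (A v * B w)) (V \<times> W)"
    if M: "M \<in> carrier_mat N N" for M
  proof -
    have cB: "B w * M * mat_adjoint (B w) \<in> carrier_mat N N" if "w \<in> W" for w
      using B(2,3)[OF that] M by auto
    have TM: "T M \<in> carrier_mat N N" using B cB M by (simp add: mat_sum_carrier)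
    have "(S \<circ> T) M = mat_sum N (\<lambda>v. mat_sum N (\<lambda>w. A v * (B w * M * mat_adjoint (B w)) * mat_adjoint (A v)) W) V"
      unfolding o_def A(5)[OF TM]
    proof (intro mat_sum_cong)
      fix v assume v: "v \<in> V"
      have c: "\<And>w. w \<in> W \<Longrightarrow> A v * (B w * M * mat_adjoint (B w)) * mat_adjoint (A v) \<in> carrier_mat N N"
        using A(2,3)[OF v] cB by auto
      show "mat_sum N (\<lambda>w. A v * (B w * M * mat_adjoint (B w)) * mat_adjoint (A v)) W \<in> carrier_mat N N"
        using c B(1) by (intro mat_sum_carrier) auto
      show "A v * T M * mat_adjoint (A v) =
          mat_sum N (\<lambda>w. A v * (B w * M * mat_adjoint (B w)) * mat_adjoint (A v)) W"
        unfolding B(5)[OF M] using A(2,3)[OF v] cB B(1) by (intro mult_mat_sum_mult) auto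
    qed (rule A)
    also have "\<dots> = mat_sum N (\<lambda>(v, w). A v * (B w * M * mat_adjoint (B w)) * mat_adjoint (A v)) (V \<times> W)"
      using A B M by (intro mat_sum_mat_sum) auto
    also have "\<dots> = mat_sum N (\<lambda>(v, w). (A v * B w) * M * mat_adjoint (A v * B w)) (V \<times> W)"
    proof (intro mat_sum_cong)
      fix x assume "x \<in> V \<times> W"
      then obtain v w where x: "x = (v, w)" "v \<in> V" "w \<in> W" by auto
      have c: "A v * B w \<in> carrier_mat N N" "B w * M \<in> carrier_mat N N"
        "A v \<in> carrier_mat N N" "mat_adjoint (A v) \<in> carrier_mat N N"
        "B w \<in> carrier_mat N N" "mat_adjoint (B w) \<in> carrier_mat N N"
        "mat_adjoint (B w) * mat_adjoint (A v) \<in> carrier_mat N N"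
        "B w * M * mat_adjoint (B w) \<in> carrier_mat N N"
        "M * mat_adjoint (B w) \<in> carrier_mat N N"
        using A(2,3)[OF x(2)] B(2,3)[OF x(3)] M by auto
      show "(case x of (v, w) \<Rightarrow> A v * (B w * M * mat_adjoint (B w)) * mat_adjoint (A v)) =
          (case x of (v, w) \<Rightarrow> (A v * B w) * M * mat_adjoint (A v * B w))"
        using c M by (simp add: x adj assoc)
      show "(case x of (v, w) \<Rightarrow> (A v * B w) * M * mat_adjoint (A v * B w)) \<in> carrier_mat N N"
        using c M by (auto simp: x)
    qed (use A B in auto)
    finally show ?thesis .
  qed
  with A B unital show ?thesis
    by (auto simp: kraus_decomposition_def case_prod_unfold)
qed

lemma kraus_decomposition_reindex:
  assumes "kraus_decomposition N V L T" "bij_betw h W V"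
  shows "kraus_decomposition N W (\<lambda>w. L (h w)) T"
proof -
  note K = kraus_decompositionD[OF assms(1)]
  have W: "finite W" "\<And>w. w \<in> W \<Longrightarrow> h w \<in> V"
    using assms(2) K(1) bij_betw_finite bij_betwE by blast+
  have "mat_sum N (\<lambda>w. mat_adjoint (L (h w)) * L (h w)) W = 1\<^sub>m N"
    using mat_sum_reindex_bij[OF K(1) assms(2), of "\<lambda>w. mat_adjoint (L w) * L w" N] K by auto
  moreover have "T M = mat_sum N (\<lambda>w. L (h w) * M * mat_adjoint (L (h w))) W"
    if "M \<in> carrier_mat N N" for M
    using mat_sum_reindex_bij[OF K(1) assms(2), of "\<lambda>w. L w * M * mat_adjoint (L w)" N] K that
    by auto
  ultimately show ?thesis using W K by (auto simp: kraus_decomposition_def)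
qed

text \<open>Iterating the composition lemma makes \<open>L'\<close> the product of the \<open>L w\<close> along a word. The index
  set shows that \<open>T ^^ m\<close> has \<open>card W ^ m\<close> Kraus operators.\<close>

lemma kraus_decomposition_funpow:
  assumes "kraus_decomposition N W L T"
  shows "\<exists>L'. kraus_decomposition N {ws. set ws \<subseteq> W \<and> length ws = m} L' (T ^^ m)"
proof (induction m)
  case 0
  have words: "{ws. set ws \<subseteq> W \<and> length ws = 0} = {[]}" by auto
  show ?case
    unfolding words funpow.simps by (rule exI, rule kraus_decomposition_id)
next
  case (Suc m)
  let ?W = "\<lambda>m. {ws. set ws \<subseteq> W \<and> length ws = m}"
  obtain L' where L': "kraus_decomposition N (?W m) L' (T ^^ m)" using Suc by blast
  have "bij_betw (\<lambda>ws. (hd ws, tl ws)) (?W (Suc m)) (W \<times> ?W m)"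
    by (rule bij_betwI[where g = "\<lambda>(w, ws). w # ws"]) (auto simp: length_Suc_conv)
  from kraus_decomposition_reindex[OF kraus_decomposition_comp[OF assms L'] this]
  show ?case unfolding funpow.simps by blast
qed

section \<open>Operator norm and Hilbert--Schmidt norm of a trace-preserving map\<close>

text \<open>Both sides are \<open>Tr (M\<^sup>* (\<Sum>\<^sub>w L(w)\<^sup>*L(w)) M)\<close>. For \<open>M = 1\<close> this fixes the total size of the
  Kraus operators; for general \<open>M\<close> it shows that each \<open>L(w)\<close> is a contraction.\<close>

lemma kraus_sum_norm2:
  assumes "kraus_decomposition N W L T" "M \<in> carrier_mat N N"
  shows "(\<Sum>w\<in>W. hs_norm2 N (L w * M)) = hs_norm2 N M"
proof -
  note K = kraus_decompositionD[OF assms(1)]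
  note M = assms(2)
  have "complex_of_real (\<Sum>w\<in>W. hs_norm2 N (L w * M)) = (\<Sum>w\<in>W. hs_inner (L w * M) (L w * M))"
    unfolding of_real_sum using K(2) M
    by (intro sum.cong refl hs_inner_norm2[symmetric]) simp
  \<comment> \<open>The factor \<open>1\<close> brings the summands into the form \<open>A * f w * B\<close> of \<open>mult_mat_sum_mult\<close>.\<close>
  also have "\<dots> = (\<Sum>w\<in>W. hs_inner (1\<^sub>m N * (mat_adjoint (L w) * L w) * M) M)"
  proof (intro sum.cong refl)
    fix w assume w: "w \<in> W"
    note c = K(2,3)[OF w] M
    have "hs_inner (L w * M) (L w * M) = cnj (hs_inner M (mat_adjoint (L w) * (L w * M)))"
      using c by (subst hs_inner_cnj[where N = N]) (auto simp: hs_inner_mult_left[where N = N])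
    also have "\<dots> = hs_inner (mat_adjoint (L w) * (L w * M)) M"
      using c by (subst hs_inner_cnj[where N = N and B = "mat_adjoint (L w) * (L w * M)"]) auto
    finally show "hs_inner (L w * M) (L w * M) = hs_inner (1\<^sub>m N * (mat_adjoint (L w) * L w) * M) M"
      using c by (simp add: assoc_mult_mat[where ?n\<^sub>1.0 = N and ?n\<^sub>2.0 = N and ?n\<^sub>3.0 = N and ?n\<^sub>4.0 = N])
  qed
  also have "\<dots> = hs_inner (1\<^sub>m N * mat_sum N (\<lambda>w. mat_adjoint (L w) * L w) W * M) M"
    using K M by (subst mult_mat_sum_mult) (auto simp: hs_inner_mat_sum_left)
  also have "\<dots> = complex_of_real (hs_norm2 N M)" using K M by (simp add: hs_inner_norm2[where N = N])
  finally show ?thesis by (simp only: of_real_eq_iff)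
qed

text \<open>The right factor \<open>L(w)\<^sup>*\<close> can be dropped, since \<open>L(w)\<close> is a contraction (pass to adjoints).
  The sum of the squared norms \<open>\<parallel>L(w) M\<parallel>\<^sup>2\<close> is then \<open>\<parallel>M\<parallel>\<^sup>2\<close>, so the triangle inequality costs no
  more than the factor \<open>card W\<close> from Cauchy--Schwarz.\<close>

lemma kraus_norm2_le:
  assumes "kraus_decomposition N W L T" "M \<in> carrier_mat N N"
  shows "hs_norm2 N (T M) \<le> real (card W) * hs_norm2 N M"
proof -
  note K = kraus_decompositionD[OF assms(1)]
  note M = assms(2)
  have "hs_norm2 N (L w * M * mat_adjoint (L w)) \<le> hs_norm2 N (L w * M)" if w: "w \<in> W" for w
  proof -
    let ?Y = "mat_adjoint (L w * M)"
    have c: "L w * M \<in> carrier_mat N N" using K(2)[OF w] M by auto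
    have "hs_norm2 N (L w * M * mat_adjoint (L w)) = hs_norm2 N (L w * ?Y)"
      using hs_norm2_adjoint[of "L w * M * mat_adjoint (L w)" N] c K(2,3)[OF w]
      by (simp add: mat_adjoint_mult[of "L w * M" N] mat_adjoint_adjoint)
    also have "\<dots> \<le> (\<Sum>v\<in>W. hs_norm2 N (L v * ?Y))"
      using K(1) w by (intro member_le_sum) (auto simp: hs_norm2_nonneg)
    also have "\<dots> = hs_norm2 N (L w * M)"
      using kraus_sum_norm2[OF assms(1) mat_adjoint_carrier[OF c]] c by (simp add: hs_norm2_adjoint)
    finally show ?thesis .
  qed
  hence "(\<Sum>w\<in>W. hs_norm2 N (L w * M * mat_adjoint (L w))) \<le> hs_norm2 N M"
    unfolding kraus_sum_norm2[OF assms, symmetric] by (rule sum_mono)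
  hence "real (card W) * (\<Sum>w\<in>W. hs_norm2 N (L w * M * mat_adjoint (L w))) \<le> real (card W) * hs_norm2 N M"
    by (intro mult_left_mono) auto
  thus ?thesis
    using hs_norm2_mat_sum_le[of W "\<lambda>w. L w * M * mat_adjoint (L w)" N] K M by auto
qed

text \<open>Two ways to compute the squared Hilbert--Schmidt norm of \<open>\<Sum>\<^sub>w a\<^sub>w a\<^sub>w\<^sup>*\<close>: the right-hand side is
  the one of the Gram matrix of the vectors \<open>a\<^sub>w\<close>.\<close>

lemma sum_norm2_rank_one_expansion:
  fixes a :: "'i \<Rightarrow> 'p \<Rightarrow> complex"
  shows "complex_of_real (\<Sum>p\<in>P. \<Sum>q\<in>P. (cmod (\<Sum>w\<in>W. a w p * cnj (a w q)))\<^sup>2) =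
    of_real (\<Sum>w\<in>W. \<Sum>v\<in>W. (cmod (\<Sum>p\<in>P. a w p * cnj (a v p)))\<^sup>2)"
proof -
  have "complex_of_real (\<Sum>p\<in>P. \<Sum>q\<in>P. (cmod (\<Sum>w\<in>W. a w p * cnj (a w q)))\<^sup>2) =
      (\<Sum>p\<in>P. \<Sum>q\<in>P. \<Sum>w\<in>W. \<Sum>v\<in>W. a w p * cnj (a w q) * (cnj (a v p) * a v q))"
    by (simp add: complex_norm_square sum_product del: of_real_power)
  also have "\<dots> = (\<Sum>w\<in>W. \<Sum>v\<in>W. \<Sum>p\<in>P. \<Sum>q\<in>P. a w p * cnj (a w q) * (cnj (a v p) * a v q))"
    by (simp only: sum.swap[where A = P and B = W])
  also have "\<dots> = (\<Sum>w\<in>W. \<Sum>v\<in>W. (\<Sum>p\<in>P. a w p * cnj (a v p)) * cnj (\<Sum>p\<in>P. a w p * cnj (a v p)))"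
    by (simp add: sum_product mult_ac)
  also have "\<dots> = of_real (\<Sum>w\<in>W. \<Sum>v\<in>W. (cmod (\<Sum>p\<in>P. a w p * cnj (a v p)))\<^sup>2)"
    by (simp add: complex_norm_square del: of_real_power)
  finally show ?thesis .
qed

text \<open>Keep only the diagonal of the Gram matrix and apply Cauchy--Schwarz to it.\<close>

lemma sum_norm2_rank_one_ge:
  fixes a :: "'i \<Rightarrow> 'p \<Rightarrow> complex"
  assumes "finite W"
  shows "(\<Sum>w\<in>W. \<Sum>p\<in>P. (cmod (a w p))\<^sup>2)\<^sup>2 \<le>
    real (card W) * (\<Sum>p\<in>P. \<Sum>q\<in>P. (cmod (\<Sum>w\<in>W. a w p * cnj (a w q)))\<^sup>2)"
proof -
  have diag: "(\<Sum>p\<in>P. (cmod (a w p))\<^sup>2)\<^sup>2 = (cmod (\<Sum>p\<in>P. a w p * cnj (a w p)))\<^sup>2" for w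
  proof -
    have "(\<Sum>p\<in>P. a w p * cnj (a w p)) = of_real (\<Sum>p\<in>P. (cmod (a w p))\<^sup>2)"
      by (simp add: complex_norm_square del: of_real_power)
    thus ?thesis by (simp only: norm_of_real power2_abs)
  qed
  have "(\<Sum>w\<in>W. \<Sum>p\<in>P. (cmod (a w p))\<^sup>2)\<^sup>2 \<le> real (card W) * (\<Sum>w\<in>W. (\<Sum>p\<in>P. (cmod (a w p))\<^sup>2)\<^sup>2)"
    using norm_sum_squared_le[OF assms, of "\<lambda>w. \<Sum>p\<in>P. (cmod (a w p))\<^sup>2"] by simp
  also have "\<dots> \<le> real (card W) * (\<Sum>w\<in>W. \<Sum>v\<in>W. (cmod (\<Sum>p\<in>P. a w p * cnj (a v p)))\<^sup>2)"
    unfolding diag using assms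
    by (intro mult_left_mono sum_mono member_le_sum[where f = "\<lambda>v. (cmod (\<Sum>p\<in>P. a _ p * cnj (a v p)))\<^sup>2"]) auto
  also have "\<dots> = real (card W) * (\<Sum>p\<in>P. \<Sum>q\<in>P. (cmod (\<Sum>w\<in>W. a w p * cnj (a w q)))\<^sup>2)"
    using sum_norm2_rank_one_expansion[of a W P, symmetric] by (simp only: of_real_eq_iff)
  finally show ?thesis .
qed

lemma kraus_mat_unit_index:
  assumes "kraus_decomposition N W L T" "i < N" "j < N" "k < N" "l < N"
  shows "T (mat_unit2 N (k, l)) $$ (i, j) = (\<Sum>w\<in>W. L w $$ (i, k) * cnj (L w $$ (j, l)))"
proof -
  note K = kraus_decompositionD[OF assms(1)]
  let ?E = "mat_unit2 N (k, l)"
  have E: "?E \<in> carrier_mat N N" by simp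
  have "(L w * ?E * mat_adjoint (L w)) $$ (i, j) = L w $$ (i, k) * cnj (L w $$ (j, l))" if w: "w \<in> W" for w
  proof -
    note c = K(2,3)[OF w]
    have LE: "(L w * ?E) $$ (i, b) = (if b = l then L w $$ (i, k) else 0)" if b: "b < N" for b
    proof -
      have "(L w * ?E) $$ (i, b) = (\<Sum>a<N. L w $$ (i, a) * ?E $$ (a, b))"
        using c assms(2-5) b by (intro mult_square_index) auto
      also have "\<dots> = (\<Sum>a<N. if a = k then (if b = l then L w $$ (i, k) else 0) else 0)"
        using assms(2-5) b by (intro sum.cong) auto
      finally have "(L w * ?E) $$ (i, b) = \<dots>" .
      thus ?thesis using assms by simp
    qed
    have LE_c: "L w * ?E \<in> carrier_mat N N" using c by auto
    have "(L w * ?E * mat_adjoint (L w)) $$ (i, j) = (\<Sum>b<N. (L w * ?E) $$ (i, b) * mat_adjoint (L w) $$ (b, j))"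
      using c LE_c assms by (intro mult_square_index) auto
    also have "\<dots> = (\<Sum>b<N. if b = l then L w $$ (i, k) * cnj (L w $$ (j, l)) else 0)"
      using c assms by (intro sum.cong) (auto simp: LE simp del: index_mult_mat(1))
    finally show ?thesis using assms by simp
  qed
  thus ?thesis using K E assms
    by (subst K(5)) (auto simp: mat_sum_index simp del: index_mult_mat(1))
qed

text \<open>The sum on the right is the squared Hilbert--Schmidt norm of \<open>T\<close>. Regrouping the indices
  \<open>(k, l)\<close>, \<open>(i, j)\<close> of a matrix entry of \<open>T\<close> as \<open>(i, k)\<close>, \<open>(j, l)\<close> turns \<open>T\<close> into the sum of the
  rank-one matrices formed from the \<open>L(w)\<close>, read as vectors of length \<open>N\<^sup>2\<close>.\<close>

lemma kraus_sum_norm2_units_ge: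
  assumes "kraus_decomposition N W L T"
  shows "(real N)\<^sup>2 \<le> real (card W) * (\<Sum>k<N. \<Sum>l<N. hs_norm2 N (T (mat_unit2 N (k, l))))"
proof -
  note K = kraus_decompositionD[OF assms]
  let ?P = "{..<N} \<times> {..<N}"
  have "(\<Sum>w\<in>W. hs_norm2 N (L w)) = hs_norm2 N (1\<^sub>m N)"
    using kraus_sum_norm2[OF assms, of "1\<^sub>m N"] K(2) by (simp add: right_mult_one_mat[of _ N])
  also have "\<dots> = (\<Sum>i<N. \<Sum>j<N. if j = i then 1 else 0)"
    unfolding hs_norm2_def by (intro sum.cong) auto
  finally have 1: "(\<Sum>w\<in>W. \<Sum>p\<in>?P. (cmod (L w $$ p))\<^sup>2) = real N"
    by (simp add: hs_norm2_def sum.cartesian_product)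
  have "(\<Sum>k<N. \<Sum>l<N. hs_norm2 N (T (mat_unit2 N (k, l)))) =
      (\<Sum>k<N. \<Sum>l<N. \<Sum>i<N. \<Sum>j<N. (cmod (\<Sum>w\<in>W. L w $$ (i, k) * cnj (L w $$ (j, l))))\<^sup>2)"
    unfolding hs_norm2_def by (intro sum.cong refl) (simp add: kraus_mat_unit_index[OF assms])
  also have "\<dots> = (\<Sum>k<N. \<Sum>i<N. \<Sum>l<N. \<Sum>j<N. (cmod (\<Sum>w\<in>W. L w $$ (i, k) * cnj (L w $$ (j, l))))\<^sup>2)"
    by (rule sum.cong[OF refl]) (rule sum.swap)
  also have "\<dots> = (\<Sum>i<N. \<Sum>k<N. \<Sum>l<N. \<Sum>j<N. (cmod (\<Sum>w\<in>W. L w $$ (i, k) * cnj (L w $$ (j, l))))\<^sup>2)"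
    by (rule sum.swap)
  also have "\<dots> = (\<Sum>i<N. \<Sum>k<N. \<Sum>j<N. \<Sum>l<N. (cmod (\<Sum>w\<in>W. L w $$ (i, k) * cnj (L w $$ (j, l))))\<^sup>2)"
    by (rule sum.cong[OF refl], rule sum.cong[OF refl]) (rule sum.swap)
  also have "\<dots> = (\<Sum>p\<in>?P. \<Sum>q\<in>?P. (cmod (\<Sum>w\<in>W. L w $$ p * cnj (L w $$ q)))\<^sup>2)"
  proof -
    have "(\<Sum>p\<in>?P. g p) = (\<Sum>i<N. \<Sum>k<N. g (i, k))" for g :: "nat \<times> nat \<Rightarrow> real"
      by (simp add: sum.cartesian_product)
    thus ?thesis by (simp only:)
  qed
  finally show ?thesis using sum_norm2_rank_one_ge[OF K(1), where a = "\<lambda>w p. L w $$ p" and P = ?P] 1 by simp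
qed

section \<open>Singular values\<close>

lemma sum_lessThan_square:
  fixes f :: "nat \<Rightarrow> nat \<Rightarrow> 'a :: comm_monoid_add"
  shows "(\<Sum>a<N * N. f (a div N) (a mod N)) = (\<Sum>i<N. \<Sum>j<N. f i j)"
proof (cases "N = 0")
  case False
  have "(\<Sum>a<N * N. f (a div N) (a mod N)) = (\<Sum>(i, j)\<in>{..<N} \<times> {..<N}. f i j)"
  proof (rule sum.reindex_bij_witness[where i = "\<lambda>(i, j). i * N + j" and j = "\<lambda>b. (b div N, b mod N)"])
    fix b assume "b \<in> {..<N * N}"
    thus "(b div N, b mod N) \<in> {..<N} \<times> {..<N}" using False by (auto simp: less_mult_imp_div_less)
  next
    fix p assume "p \<in> {..<N} \<times> {..<N}"
    then obtain i j where p: "p = (i, j)" "i < N" "j < N" by auto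
    have "i * N + j < Suc i * N" using p by simp
    also have "\<dots> \<le> N * N" using p by (intro mult_right_mono) auto
    finally show "(case p of (i, j) \<Rightarrow> i * N + j) \<in> {..<N * N}" using p by simp
  qed auto
  thus ?thesis by (simp add: sum.cartesian_product)
qed auto

text \<open>The trace is invariant under the similarity to a Schur triangular form, whose diagonal lists
  the roots of the characteristic polynomial.\<close>

lemma sum_mset_proots_char_poly:
  assumes A: "A \<in> carrier_mat n n"
  shows "\<Sum>\<^sub># (proots (char_poly A)) = mat_trace A"
proof -
  obtain es where es: "char_poly A = (\<Prod>a\<leftarrow>es. [:- a, 1:])" using char_poly_factorized[OF A] by auto
  obtain B P Q where schur: "schur_decomposition A es = (B, P, Q)" by (metis prod_cases3)
  from schur_decomposition[OF A es schur]
  have sim: "similar_mat_wit A B P Q" and diag: "diag_mat B = es" by auto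
  note w = similar_mat_witD2[OF A sim]
  have "mat_trace A = mat_trace (P * (B * Q))" using w by (simp add: assoc_mult_mat[of P n n B n Q n])
  also have "\<dots> = mat_trace (B * Q * P)" using w by (intro mat_trace_commute) auto
  also have "\<dots> = mat_trace B" using w by (simp add: assoc_mult_mat[of B n n Q n P n])
  also have "\<dots> = sum_list es"
    unfolding diag[symmetric] diag_mat_def mat_trace_def
    by (simp add: sum_list_sum_nth lessThan_atLeast0)
  also have "proots (char_poly A) = mset es"
  proof -
    have "proots (\<Prod>a\<leftarrow>es. [:- a, 1:]) = mset es"
    proof (induction es)
      case (Cons e es)
      have "(\<Prod>a\<leftarrow>es. [:- a, 1:]) \<noteq> 0" by (auto simp: prod_list_zero_iff)
      thus ?case using Cons by (simp add: proots_mult del: mult_pCons_left)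
    qed auto
    thus ?thesis by (simp add: es)
  qed
  ultimately show ?thesis by (simp add: sum_mset_sum_list)
qed

text \<open>Eigenvectors of the \<open>N\<^sup>2 \<times> N\<^sup>2\<close> matrix of \<open>F\<close> are read back as \<open>N \<times> N\<close> matrices, row by row.\<close>

lemma op_eigenvalue_obtains_eigenvector:
  assumes F: "mat_linear N F" and z: "z \<in># op_eigenvalues N F"
  obtains V where "V \<in> carrier_mat N N" "V \<noteq> 0\<^sub>m N N" "F V = z \<cdot>\<^sub>m V"
proof -
  have M: "op_mat N F \<in> carrier_mat (N * N) (N * N)" by (simp add: op_mat_def)
  have "char_poly (op_mat N F) \<noteq> 0" using degree_monic_char_poly[OF M] by auto
  hence "eigenvalue (op_mat N F) z"
    using z eigenvalue_root_char_poly[OF M] by (simp add: op_eigenvalues_def)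
  then obtain v where v: "v \<in> carrier_vec (N * N)" "v \<noteq> 0\<^sub>v (N * N)" "op_mat N F *\<^sub>v v = z \<cdot>\<^sub>v v"
    using M by (auto simp: eigenvalue_def eigenvector_def)
  define V where "V = mat N N (\<lambda>(i, j). v $ (i * N + j))"
  have V: "V \<in> carrier_mat N N" by (simp add: V_def)
  have FV: "F V \<in> carrier_mat N N" using F V unfolding mat_linear_def by blast
  have lt: "i * N + j < N * N" if "i < N" "j < N" for i j
  proof -
    have "i * N + j < Suc i * N" using that by simp
    also have "\<dots> \<le> N * N" using that by (intro mult_right_mono) auto
    finally show ?thesis .
  qed
  have "F V = z \<cdot>\<^sub>m V"
  proof (rule eq_matI)
    fix i j assume "i < dim_row (z \<cdot>\<^sub>m V)" "j < dim_col (z \<cdot>\<^sub>m V)"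
    hence ij: "i < N" "j < N" using V by auto
    have "(op_mat N F *\<^sub>v v) $ (i * N + j) = F V $$ (i, j)"
      using lt[OF ij] ij by (simp add: op_mat_mult_vec[OF F v(1)] V_def)
    thus "F V $$ (i, j) = (z \<cdot>\<^sub>m V) $$ (i, j)"
      using v(1) lt[OF ij] ij by (simp add: v(3) V_def)
  qed (use FV V in auto)
  moreover have "V \<noteq> 0\<^sub>m N N"
  proof
    assume 0: "V = 0\<^sub>m N N"
    have "v = 0\<^sub>v (N * N)"
    proof (rule eq_vecI)
      fix a assume "a < dim_vec (0\<^sub>v (N * N) :: complex vec)"
      hence a: "a < N * N" by simp
      hence "N > 0" by (cases N) auto
      hence a': "a div N < N" "a mod N < N" using a by (auto simp: less_mult_imp_div_less)
      have "V $$ (a div N, a mod N) = 0" using a' by (simp add: 0)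
      thus "v $ a = 0\<^sub>v (N * N) $ a" using a a' by (simp add: V_def)
    qed (use v in auto)
    with v show False by simp
  qed
  ultimately show ?thesis using V that by blast
qed

lemma mat_linear_hs_adjoint_comp:
  assumes "mat_linear N T"
  shows "mat_linear N (hs_adjoint N T \<circ> T)"
  using assms mat_linear_hs_adjoint[OF assms] by (auto simp: mat_linear_def)

lemma hs_inner_hs_adjoint_self:
  assumes T: "mat_linear N T" and A: "A \<in> carrier_mat N N"
  shows "hs_inner A (hs_adjoint N T (T A)) = of_real (hs_norm2 N (T A))"
proof -
  have TA: "T A \<in> carrier_mat N N" using T A by (auto simp: mat_linear_def)
  show ?thesis using hs_adjoint(2)[OF T TA A] hs_inner_norm2[OF TA] by simp
qed

text \<open>For an eigenvector \<open>V\<close> of \<open>T\<^sup>*T\<close>, the eigenvalue is the quotient \<open>\<parallel>T(V)\<parallel>\<^sup>2 / \<parallel>V\<parallel>\<^sup>2\<close>.\<close>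

lemma op_eigenvalue_le:
  assumes T: "mat_linear N T" and z: "z \<in># op_eigenvalues N (hs_adjoint N T \<circ> T)"
    and bound: "\<And>A. A \<in> carrier_mat N N \<Longrightarrow> hs_norm2 N (T A) \<le> C * hs_norm2 N A"
  shows "Re z \<le> C"
proof -
  obtain V where V: "V \<in> carrier_mat N N" "V \<noteq> 0\<^sub>m N N" "hs_adjoint N T (T V) = z \<cdot>\<^sub>m V"
    using op_eigenvalue_obtains_eigenvector[OF mat_linear_hs_adjoint_comp[OF T] z] by auto
  have "complex_of_real (hs_norm2 N (T V)) = hs_inner V (z \<cdot>\<^sub>m V)"
    using hs_inner_hs_adjoint_self[OF T V(1)] V(3) by simp
  also have "\<dots> = cnj z * of_real (hs_norm2 N V)"
    using V(1) hs_inner_cnj[of "z \<cdot>\<^sub>m V" N V]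
    by (simp add: hs_inner_smult_left[where N = N] hs_inner_norm2[where N = N])
  finally have "hs_norm2 N (T V) = Re z * hs_norm2 N V"
    by (simp add: complex_eq_iff)
  hence "Re z * hs_norm2 N V \<le> C * hs_norm2 N V" using bound[OF V(1)] by simp
  moreover have "hs_norm2 N V > 0" using hs_inner_self_pos[OF V(1,2)] by (simp add: hs_norm2_def)
  ultimately show ?thesis by simp
qed

text \<open>The trace of \<open>T\<^sup>*T\<close>, computed in the orthonormal basis of matrix units.\<close>

lemma sum_op_eigenvalues_hs_adjoint:
  assumes T: "mat_linear N T"
  shows "\<Sum>\<^sub># (op_eigenvalues N (hs_adjoint N T \<circ> T)) =
    of_real (\<Sum>k<N. \<Sum>l<N. hs_norm2 N (T (mat_unit2 N (k, l))))"
proof -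
  let ?F = "hs_adjoint N T \<circ> T"
  have unit: "cnj (?F (mat_unit2 N (k, l)) $$ (k, l)) = of_real (hs_norm2 N (T (mat_unit2 N (k, l))))"
    if "k < N" "l < N" for k l
  proof -
    let ?E = "mat_unit2 N (k, l)"
    have FE: "?F ?E \<in> carrier_mat N N"
      using mat_linear_hs_adjoint_comp[OF T] mat_carrier unfolding mat_linear_def by blast
    have "hs_inner ?E (?F ?E) = (\<Sum>i<N. \<Sum>j<N. if j = l then if i = k then cnj (?F ?E $$ (i, j)) else 0 else 0)"
      unfolding hs_inner_sum[OF mat_carrier FE] by (intro sum.cong) auto
    also have "\<dots> = cnj (?F ?E $$ (k, l))" using that by simp
    finally show ?thesis using hs_inner_hs_adjoint_self[OF T, of ?E] by simp
  qed
  have "\<Sum>\<^sub># (op_eigenvalues N ?F) = mat_trace (op_mat N ?F)"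
    unfolding op_eigenvalues_def by (rule sum_mset_proots_char_poly) (auto simp: op_mat_def)
  also have "\<dots> = (\<Sum>a<N * N. ?F (mat_unit2 N (a div N, a mod N)) $$ (a div N, a mod N))"
    by (simp add: mat_trace_def op_mat_def mat_unit_def)
  also have "\<dots> = (\<Sum>k<N. \<Sum>l<N. ?F (mat_unit2 N (k, l)) $$ (k, l))"
    by (rule sum_lessThan_square)
  also have "\<dots> = (\<Sum>k<N. \<Sum>l<N. of_real (hs_norm2 N (T (mat_unit2 N (k, l)))))"
  proof (intro sum.cong refl)
    fix k l assume "k \<in> {..<N}" "l \<in> {..<N}"
    hence "cnj (cnj (?F (mat_unit2 N (k, l)) $$ (k, l))) = cnj (of_real (hs_norm2 N (T (mat_unit2 N (k, l)))))"
      by (subst unit) auto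
    thus "?F (mat_unit2 N (k, l)) $$ (k, l) = of_real (hs_norm2 N (T (mat_unit2 N (k, l))))" by simp
  qed
  finally show ?thesis by simp
qed

lemma Re_sum_mset: "Re (\<Sum>\<^sub># M) = (\<Sum>z\<in>#M. Re z)"
  by (induction M) auto

lemma sum_list_squares_le_decreasing:
  fixes xs :: "real list"
  assumes "sorted (rev xs)" "\<And>x. x \<in> set xs \<Longrightarrow> x \<ge> 0" "length xs \<ge> 2"
  shows "(\<Sum>x\<leftarrow>xs. x\<^sup>2) \<le> (xs ! 0)\<^sup>2 + real (length xs - 1) * (xs ! 1)\<^sup>2"
proof -
  obtain x y zs where xs: "xs = x # y # zs" using assms(3)
    by (metis One_nat_def Suc_le_length_iff numeral_2_eq_2)
  have "\<And>z. z \<in> set zs \<Longrightarrow> z\<^sup>2 \<le> y\<^sup>2"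
    using assms by (intro power_mono) (auto simp: xs sorted_append)
  hence "(\<Sum>z\<leftarrow>zs. z\<^sup>2) \<le> (\<Sum>z\<leftarrow>zs. y\<^sup>2)" by (intro sum_list_mono) auto
  thus ?thesis by (simp add: xs sum_list_triv algebra_simps)
qed

text \<open>The left-hand side is \<open>s\<^sub>1\<^sup>2 + s\<^sub>2\<^sup>2 + \<dots>\<close>, with \<open>s\<^sub>1\<^sup>2 \<le> C\<close> and the other \<open>N\<^sup>2 - 1\<close> terms
  at most \<open>s\<^sub>2\<^sup>2\<close>.\<close>

lemma second_singular_value_ge:
  assumes T: "mat_linear N T" and N: "N \<ge> 2"
    and bound: "\<And>A. A \<in> carrier_mat N N \<Longrightarrow> hs_norm2 N (T A) \<le> C * hs_norm2 N A"
  shows "(\<Sum>k<N. \<Sum>l<N. hs_norm2 N (T (mat_unit2 N (k, l)))) \<le>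
      C + ((real N)\<^sup>2 - 1) * (singular_value N T 2)\<^sup>2"
    and "singular_value N T 2 \<ge> 0"
proof -
  let ?E = "op_eigenvalues N (hs_adjoint N T \<circ> T)"
  let ?xs = "singular_values N T"
  have mset: "mset ?xs = image_mset (\<lambda>z. sqrt (Re z)) ?E"
    by (simp add: singular_values_def)
  have len: "length ?xs = N * N" by (rule length_singular_values)
  have NN: "2 * 2 \<le> N * N" using N by (intro mult_mono) auto
  have ex: "\<exists>z. z \<in># ?E \<and> x = sqrt (Re z)" if "x \<in> set ?xs" for x
    using that unfolding set_mset_mset[symmetric] mset by auto
  have nonneg: "x \<ge> 0" if "x \<in> set ?xs" for x
    using ex[OF that] op_eigenvalues_nonneg(2)[OF T] by auto
  have "?xs ! 0 \<in> set ?xs" "?xs ! 1 \<in> set ?xs" using len NN by (auto intro!: nth_mem)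
  from ex[OF this(1)] have top: "(?xs ! 0)\<^sup>2 \<le> C"
    using op_eigenvalue_le[OF T _ bound] op_eigenvalues_nonneg(2)[OF T] by auto
  show "singular_value N T 2 \<ge> 0"
    unfolding singular_value_def using nonneg[OF \<open>?xs ! 1 \<in> set ?xs\<close>] by simp
  have "(\<Sum>k<N. \<Sum>l<N. hs_norm2 N (T (mat_unit2 N (k, l)))) = Re (\<Sum>\<^sub># ?E)"
    by (simp add: sum_op_eigenvalues_hs_adjoint[OF T])
  also have "\<dots> = (\<Sum>z\<in>#?E. Re z)"
    using Re_sum_mset by blast
  also have "\<dots> = (\<Sum>x\<in>#mset ?xs. x\<^sup>2)"
    unfolding mset image_mset.compositionality
    by (intro arg_cong[where f = sum_mset] image_mset_cong) (simp add: op_eigenvalues_nonneg(2)[OF T])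
  also have "\<dots> = (\<Sum>x\<leftarrow>?xs. x\<^sup>2)" by (simp flip: sum_mset_sum_list)
  also have "\<dots> \<le> (?xs ! 0)\<^sup>2 + real (length ?xs - 1) * (?xs ! 1)\<^sup>2"
    using nonneg len NN by (intro sum_list_squares_le_decreasing) (auto simp: singular_values_def)
  also have "\<dots> \<le> C + ((real N)\<^sup>2 - 1) * (singular_value N T 2)\<^sup>2"
  proof -
    have "1 \<le> N * N" using NN by linarith
    from of_nat_diff[OF this, where ?'a = real]
    have "real (N * N - 1) = (real N)\<^sup>2 - 1" by (simp add: power2_eq_square)
    thus ?thesis using top by (simp add: len singular_value_def)
  qed
  finally show "(\<Sum>k<N. \<Sum>l<N. hs_norm2 N (T (mat_unit2 N (k, l)))) \<le>
      C + ((real N)\<^sup>2 - 1) * (singular_value N T 2)\<^sup>2" .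
qed

text \<open>With \<open>n = N\<close>, the two norm bounds give \<open>n\<^sup>2 - D\<^sup>2 \<le> (n\<^sup>2 - 1) D s\<^sub>2\<^sup>2\<close>. Since
  \<open>exp (- 1/n) \<le> n/(n + 1)\<close>, it suffices that \<open>n\<^sup>2 - D\<^sup>2\<close> is at least \<open>(n\<^sup>2 - 1) n/(n + 1) = n\<^sup>2 - n\<close>,
  for which \<open>D\<^sup>2 \<le> n\<close> is enough.\<close>

lemma kraus_second_singular_value_ge:
  assumes K: "kraus_decomposition N W L T" and N: "N \<ge> 2"
    and D: "card W \<noteq> 0" "(real (card W))\<^sup>2 \<le> real N"
  shows "singular_value N T 2 \<ge> exp (- (1 / (2 * real N))) / sqrt (real (card W))"
proof -
  define D where "D = real (card W)"
  define n where "n = real N"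
  let ?s = "singular_value N T 2"
  have D: "D > 0" "D\<^sup>2 \<le> n" and n: "n \<ge> 2" using D N by (auto simp: D_def n_def)
  note s = second_singular_value_ge[OF kraus_decomposition_linear[OF K] N kraus_norm2_le[OF K]]
  have "n\<^sup>2 \<le> D * (D + (n\<^sup>2 - 1) * ?s\<^sup>2)"
    using kraus_sum_norm2_units_ge[OF K] s(1) D unfolding D_def[symmetric] n_def[symmetric]
    by (meson mult_left_mono order_trans less_imp_le)
  hence 1: "n\<^sup>2 - D\<^sup>2 \<le> (n\<^sup>2 - 1) * (D * ?s\<^sup>2)" by (simp add: algebra_simps power2_eq_square)
  have "exp (- (1 / n)) \<le> n / (n + 1)"
  proof -
    have "1 + 1 / n \<le> exp (1 / n)" by (rule exp_ge_add_one_self)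
    thus ?thesis using n by (simp add: exp_minus field_simps)
  qed
  hence "(n\<^sup>2 - 1) * exp (- (1 / n)) \<le> (n\<^sup>2 - 1) * (n / (n + 1))"
    using n by (intro mult_left_mono) auto
  also have "\<dots> = n\<^sup>2 - n" using n by (simp add: field_simps power2_eq_square)
  also have "\<dots> \<le> n\<^sup>2 - D\<^sup>2" using D n by simp
  finally have "(n\<^sup>2 - 1) * exp (- (1 / n)) \<le> (n\<^sup>2 - 1) * (D * ?s\<^sup>2)" using 1 by simp
  moreover have "n\<^sup>2 - 1 > 0" using n by (simp add: one_less_power)
  ultimately have "exp (- (1 / n)) \<le> D * ?s\<^sup>2" by simp
  hence "(exp (- (1 / (2 * n))))\<^sup>2 \<le> (sqrt D * ?s)\<^sup>2"
    using D by (simp add: power_mult_distrib exp_double[symmetric])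
  hence "exp (- (1 / (2 * n))) \<le> sqrt D * ?s"
    by (rule power2_le_imp_le) (use s(2) D in auto)
  thus ?thesis using D by (simp add: D_def n_def field_simps)
qed

theorem lemma1p4:
  fixes N d m :: nat and K :: "nat \<Rightarrow> complex mat" and \<rho>\<^sub>d :: real
  assumes "N \<ge> 2" and "2 \<le> d" and "real d \<le> real N powr (1 / 4)"
    and "\<And>s. s \<in> {1..d} \<Longrightarrow> K s \<in> carrier_mat N N"
    and "mat_sum N (\<lambda>s. mat_adjoint (K s) * K s) {1..d} = 1\<^sub>m N"
    and "m = nat \<lfloor>ln (real N) / (4 * ln (real d))\<rfloor>"
    and "\<rho>\<^sub>d = 1 / sqrt (real d)"
  shows "singular_value N (kraus_map N d K ^^ m) 2 powr (1 / real m) \<ge> \<rho>\<^sub>d * exp (- (1 / (2 * real N)))"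
proof -
  define x where "x = 1 / (2 * real N)"
  define W where "W = {ws. set ws \<subseteq> {1..d} \<and> length ws = m}"
  have x: "x \<ge> 0" by (simp add: x_def)
  have d: "ln (real d) > 0" "real d > 0" using assms(2) by auto
  have "ln (real d) \<le> ln (real N powr (1 / 4))" using assms(1-3) by (simp del: ln_powr)
  also have "\<dots> = ln (real N) / 4" using assms(1) by (simp add: ln_powr)
  finally have "1 \<le> ln (real N) / (4 * ln (real d))" using d by (simp add: field_simps)
  hence m: "m \<ge> 1" "real m \<le> ln (real N) / (4 * ln (real d))"
    unfolding assms(6) by linarith+

  have "kraus_decomposition N {1..d} K (kraus_map N d K)"
    using assms(4,5) by (auto simp: kraus_decomposition_def kraus_map_def)
  from kraus_decomposition_funpow[OF this, of m]
  obtain L where L: "kraus_decomposition N W L (kraus_map N d K ^^ m)" unfolding W_def by blast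
  have card: "card W = d ^ m" unfolding W_def by (subst card_lists_length_eq) auto

  have "ln ((real d ^ m) ^ 4) = 4 * (real m * ln (real d))"
    using d by (simp add: ln_realpow)
  also have "\<dots> \<le> ln (real N)" using m(2) d by (simp add: field_simps)
  finally have "(real d ^ m) ^ 4 \<le> real N" using d assms(1) by simp
  moreover have "(real d ^ m)\<^sup>2 \<le> (real d ^ m) ^ 4"
    using assms(2) by (intro power_increasing) auto
  ultimately have "singular_value N (kraus_map N d K ^^ m) 2 \<ge> exp (- x) / sqrt (real d ^ m)"
    using kraus_second_singular_value_ge[OF L assms(1)] d by (simp add: card x_def)
  moreover have "exp (- x) / sqrt (real d ^ m) = exp (- x - real m * ln (sqrt (real d)))"
    using d by (simp add: exp_diff exp_of_nat_mult real_sqrt_power)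
  \<comment> \<open>The \<open>m\<close>-th root turns \<open>x\<close> into \<open>x / m \<le> x\<close>.\<close>
  ultimately have "exp (- x - real m * ln (sqrt (real d))) powr (1 / real m) \<le>
      singular_value N (kraus_map N d K ^^ m) 2 powr (1 / real m)"
    by (intro powr_mono2) auto
  moreover have "exp (- x - real m * ln (sqrt (real d))) powr (1 / real m) =
      exp (- (x / real m) - ln (sqrt (real d)))"
    using m(1) by (simp add: exp_powr_real field_simps)
  moreover have "exp (- x - ln (sqrt (real d))) \<le> exp (- (x / real m) - ln (sqrt (real d)))"
    using m(1) x by (simp add: divide_le_eq mult_le_cancel_left1)
  moreover have "\<rho>\<^sub>d * exp (- (1 / (2 * real N))) = exp (- x - ln (sqrt (real d)))"
    using d by (simp add: exp_diff assms(7) x_def)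
  ultimately show ?thesis by linarith
qed

end
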